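(* Let $X$ be a set. The free restriction monoid $FRM_X$ on $X$ is isomorphic to $W(X^*,Y)$, where $X^*$ is the free monoid on $X$, acting on the semilattice of projections $Y=P_{FRM_X}$ of $FRM_X$ according to the Munn representation; that is, the action is given by the monoidal homomorphism $X^*\to T_Y$, $w\mapsto\theta_{\overline w}$, where $\overline w$ denotes the image of $w$ under the monoid homomorphism $X^*\to FRM_X$ extending the inclusion of $X$, and $\theta$ is the Munn representation of $FRM_X$.
   Context: A restriction semigroup is an algebra $(S,\cdot,{}^+,{}^* )$ with $(S,\cdot)$ a semigroup, satisfying $x^+x=x$, $(x^+y)^+=x^+y^+$, $x^+y^+=y^+x^+$, $xy^+=(xy)^+x$, the dual identities $xx^*=x$, $(yx^* )^*=y^*x^*$, $y^*x^*=x^*y^*$, $y^*x=x(yx)^*$, and $(x^+)^*=x^+$, $(x^* )^+=x^*$. Its projections form the semilattice $P_S=\{x^+:x\in S\}=\{x^*:x\in S\}$. A restriction monoid is a restriction semigroup with identity $1$ (so $1^+=1^*=1$). $FRM_X$ is the free object on $X$ in the variety of restriction monoids (signature $\cdot,{}^+,{}^*,1$). For a semilattice $Y$, ideals are nonempty downward-closed subsets. $T_Y$ is the inverse semigroup of all isomorphisms between principal ideals of $Y$, under composition of partial maps (written on the right, composed left to right). The Munn representation of a restriction semigroup $S$ is $\theta:S\to T_{P_S}$, where $\theta_a$ has domain $\{e\in P_S:e\le a^+\}$ and $e\theta_a=(ea)^*$; it is a homomorphism, monoidal if $S$ is a monoid. For a monoid $T$ and a monoidal homomorphism $\alpha:T\to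 T_Y$ ($Y$ a semilattice with identity), write $\Delta t,\nabla t$ for the domain and range of $t\alpha$, and $e^t=e(t\alpha)$ for $e\in\Delta t$. Then $W(T,Y)=\{(t,e^t)\in T\times Y: e\in\Delta t\}=\{(t,f)\in T\times Y: f\in\nabla t\}$, with $(t,e^t)(u,f^u)=(tu,(e^tf)^u)$, $(t,e^t)^+=(1,e)$, $(t,f)^*=(1,f)$. *)

theory Defs
  imports "HOL-Algebra.Group"
begin

section \<open>Restriction monoids\<close>

record 'a restr = "'a monoid" +
  rplus :: "'a \<Rightarrow> 'a"
  rstar :: "'a \<Rightarrow> 'a"

locale restriction_monoid = monoid S for S :: "('a, 'b) restr_scheme" (structure) +
  assumes rplus_closed: "x \<in> carrier S \<Longrightarrow> rplus S x \<in> carrier S"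
    and rstar_closed: "x \<in> carrier S \<Longrightarrow> rstar S x \<in> carrier S"
    and rplus_mult_self: "x \<in> carrier S \<Longrightarrow> rplus S x \<otimes> x = x"
    and rplus_rplus_mult: "\<lbrakk>x \<in> carrier S; y \<in> carrier S\<rbrakk> \<Longrightarrow>
          rplus S (rplus S x \<otimes> y) = rplus S x \<otimes> rplus S y"
    and rplus_comm: "\<lbrakk>x \<in> carrier S; y \<in> carrier S\<rbrakk> \<Longrightarrow>
          rplus S x \<otimes> rplus S y = rplus S y \<otimes> rplus S x"
    and mult_rplus: "\<lbrakk>x \<in> carrier S; y \<in> carrier S\<rbrakk> \<Longrightarrow>
          x \<otimes> rplus S y = rplus S (x \<otimes> y) \<otimes> x"
    and mult_self_rstar: "x \<in> carrier S \<Longrightarrow> x \<otimes> rstar S x = x"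
    and rstar_mult_rstar: "\<lbrakk>x \<in> carrier S; y \<in> carrier S\<rbrakk> \<Longrightarrow>
          rstar S (y \<otimes> rstar S x) = rstar S y \<otimes> rstar S x"
    and rstar_comm: "\<lbrakk>x \<in> carrier S; y \<in> carrier S\<rbrakk> \<Longrightarrow>
          rstar S y \<otimes> rstar S x = rstar S x \<otimes> rstar S y"
    and rstar_mult: "\<lbrakk>x \<in> carrier S; y \<in> carrier S\<rbrakk> \<Longrightarrow>
          rstar S y \<otimes> x = x \<otimes> rstar S (y \<otimes> x)"
    and rstar_rplus: "x \<in> carrier S \<Longrightarrow> rstar S (rplus S x) = rplus S x"
    and rplus_rstar: "x \<in> carrier S \<Longrightarrow> rplus S (rstar S x) = rstar S x"

definition monoid_hom :: "('a, 'c) monoid_scheme \<Rightarrow> ('b, 'd) monoid_scheme \<Rightarrow> ('a \<Rightarrow> 'b) set" where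
  "monoid_hom S T = {h \<in> hom S T. h \<one>\<^bsub>S\<^esub> = \<one>\<^bsub>T\<^esub>}"

definition restr_hom :: "('a, 'c) restr_scheme \<Rightarrow> ('b, 'd) restr_scheme \<Rightarrow> ('a \<Rightarrow> 'b) set" where
  "restr_hom S T = {h \<in> monoid_hom S T.
     \<forall>x\<in>carrier S. h (rplus S x) = rplus T (h x) \<and> h (rstar S x) = rstar T (h x)}"

definition restr_isomorphic :: "('a, 'c) restr_scheme \<Rightarrow> ('b, 'd) restr_scheme \<Rightarrow> bool" where
  "restr_isomorphic S T \<longleftrightarrow> (\<exists>h \<in> restr_hom S T. bij_betw h (carrier S) (carrier T))"

definition projections :: "('a, 'b) restr_scheme \<Rightarrow> 'a monoid" where
  "projections S = \<lparr>carrier = rplus S ` carrier S, mult = mult S, one = one S\<rparr>"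


section \<open>The free restriction monoid\<close>

text \<open>The free object on \<open>X\<close> in the variety of restriction monoids is built as usual: terms over
  \<open>X\<close> in the signature, modulo the congruence generated by the defining identities.\<close>

datatype 'x rterm =
    Gen 'x
  | Unit
  | Mult "'x rterm" "'x rterm"
  | Plus "'x rterm"
  | Star "'x rterm"

definition rterms :: "'x set \<Rightarrow> 'x rterm set" where
  "rterms X = {t. set_rterm t \<subseteq> X}"

inductive_set req :: "'x set \<Rightarrow> ('x rterm \<times> 'x rterm) set" for X :: "'x set" where
  refl: "s \<in> rterms X \<Longrightarrow> (s, s) \<in> req X"
| sym: "(s, t) \<in> req X \<Longrightarrow> (t, s) \<in> req X"
| trans: "(s, t) \<in> req X \<Longrightarrow> (t, u) \<in> req X \<Longrightarrow> (s, u) \<in> req X"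
| cong_Mult: "(s, s') \<in> req X \<Longrightarrow> (t, t') \<in> req X \<Longrightarrow> (Mult s t, Mult s' t') \<in> req X"
| cong_Plus: "(s, s') \<in> req X \<Longrightarrow> (Plus s, Plus s') \<in> req X"
| cong_Star: "(s, s') \<in> req X \<Longrightarrow> (Star s, Star s') \<in> req X"
| assoc: "\<lbrakk>s \<in> rterms X; t \<in> rterms X; u \<in> rterms X\<rbrakk> \<Longrightarrow>
    (Mult (Mult s t) u, Mult s (Mult t u)) \<in> req X"
| unit_left: "s \<in> rterms X \<Longrightarrow> (Mult Unit s, s) \<in> req X"
| unit_right: "s \<in> rterms X \<Longrightarrow> (Mult s Unit, s) \<in> req X"
| plus_self: "s \<in> rterms X \<Longrightarrow> (Mult (Plus s) s, s) \<in> req X"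
| plus_plus: "\<lbrakk>s \<in> rterms X; t \<in> rterms X\<rbrakk> \<Longrightarrow>
    (Plus (Mult (Plus s) t), Mult (Plus s) (Plus t)) \<in> req X"
| plus_comm: "\<lbrakk>s \<in> rterms X; t \<in> rterms X\<rbrakk> \<Longrightarrow>
    (Mult (Plus s) (Plus t), Mult (Plus t) (Plus s)) \<in> req X"
| mult_plus: "\<lbrakk>s \<in> rterms X; t \<in> rterms X\<rbrakk> \<Longrightarrow>
    (Mult s (Plus t), Mult (Plus (Mult s t)) s) \<in> req X"
| self_star: "s \<in> rterms X \<Longrightarrow> (Mult s (Star s), s) \<in> req X"
| star_star: "\<lbrakk>s \<in> rterms X; t \<in> rterms X\<rbrakk> \<Longrightarrow>
    (Star (Mult t (Star s)), Mult (Star t) (Star s)) \<in> req X"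
| star_comm: "\<lbrakk>s \<in> rterms X; t \<in> rterms X\<rbrakk> \<Longrightarrow>
    (Mult (Star t) (Star s), Mult (Star s) (Star t)) \<in> req X"
| star_mult: "\<lbrakk>s \<in> rterms X; t \<in> rterms X\<rbrakk> \<Longrightarrow>
    (Mult (Star t) s, Mult s (Star (Mult t s))) \<in> req X"
| star_plus: "s \<in> rterms X \<Longrightarrow> (Star (Plus s), Plus s) \<in> req X"
| plus_star: "s \<in> rterms X \<Longrightarrow> (Plus (Star s), Star s) \<in> req X"

definition rclass :: "'x set \<Rightarrow> 'x rterm \<Rightarrow> 'x rterm set" where
  "rclass X t = req X `` {t}"

definition FRM :: "'x set \<Rightarrow> 'x rterm set restr" where
  "FRM X = \<lparr>carrier = rterms X // req X,
            mult = (\<lambda>A B. \<Union>s\<in>A. \<Union>t\<in>B. rclass X (Mult s t)),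
            one = rclass X Unit,
            rplus = (\<lambda>A. \<Union>s\<in>A. rclass X (Plus s)),
            rstar = (\<lambda>A. \<Union>s\<in>A. rclass X (Star s))\<rparr>"

definition frm_gen :: "'x set \<Rightarrow> 'x \<Rightarrow> 'x rterm set" where
  "frm_gen X x = rclass X (Gen x)"


section \<open>The free monoid\<close>

definition free_monoid :: "'x set \<Rightarrow> 'x list monoid" where
  "free_monoid X = \<lparr>carrier = lists X, mult = (@), one = []\<rparr>"

definition word_ext :: "('a, 'b) monoid_scheme \<Rightarrow> ('x \<Rightarrow> 'a) \<Rightarrow> 'x list \<Rightarrow> 'a" where
  "word_ext M g w = foldr (\<lambda>x a. g x \<otimes>\<^bsub>M\<^esub> a) w \<one>\<^bsub>M\<^esub>"

definition frm_word :: "'x set \<Rightarrow> 'x list \<Rightarrow> 'x rterm set" where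
  "frm_word X = word_ext (FRM X) (frm_gen X)"


section \<open>Semilattices, partial isomorphisms, the Munn representation\<close>

text \<open>A semilattice is a commutative idempotent structure, ordered by \<open>e \<le> f\<close> iff \<open>e = e f\<close>.
  Partial maps of \<open>Y\<close> are functions into the option type, composed from left to right.\<close>

locale semilattice_monoid = comm_monoid Y for Y (structure) +
  assumes idem: "e \<in> carrier Y \<Longrightarrow> e \<otimes> e = e"

definition sl_le :: "('a, 'b) monoid_scheme \<Rightarrow> 'a \<Rightarrow> 'a \<Rightarrow> bool" where
  "sl_le Y e f \<longleftrightarrow> e = e \<otimes>\<^bsub>Y\<^esub> f"

definition principal_ideal :: "('a, 'b) monoid_scheme \<Rightarrow> 'a \<Rightarrow> 'a set" where
  "principal_ideal Y a = {e \<in> carrier Y. sl_le Y e a}"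

definition munn_semigroup :: "'a monoid \<Rightarrow> ('a \<Rightarrow> 'a option) monoid" where
  "munn_semigroup Y =
     \<lparr>carrier = {\<phi>. \<exists>a\<in>carrier Y. \<exists>b\<in>carrier Y.
          dom \<phi> = principal_ideal Y a \<and>
          (\<lambda>e. the (\<phi> e)) \<in> iso (Y\<lparr>carrier := principal_ideal Y a\<rparr>)
                             (Y\<lparr>carrier := principal_ideal Y b\<rparr>)},
      mult = (\<lambda>\<phi> \<psi>. \<psi> \<circ>\<^sub>m \<phi>),
      one = Some |` carrier Y\<rparr>"

definition munn_rep :: "('a, 'b) restr_scheme \<Rightarrow> 'a \<Rightarrow> ('a \<Rightarrow> 'a option)" where
  "munn_rep S a =
     (\<lambda>e. if e \<in> principal_ideal (projections S) (rplus S a)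
          then Some (rstar S (e \<otimes>\<^bsub>S\<^esub> a)) else None)"


section \<open>The restriction monoid \<open>W(T, Y)\<close>\<close>

text \<open>For \<open>f\<close> in the range of \<open>\<alpha> t\<close>, \<open>act_inv \<alpha> t f\<close> is the unique \<open>e\<close> in its domain with
  \<open>e\<^sup>t = f\<close>. An element \<open>(t, f)\<close> of \<open>W(T, Y)\<close> is therefore \<open>(t, e\<^sup>t)\<close> with \<open>e = act_inv \<alpha> t f\<close>.\<close>

definition act_inv :: "('t \<Rightarrow> 'a \<Rightarrow> 'a option) \<Rightarrow> 't \<Rightarrow> 'a \<Rightarrow> 'a" where
  "act_inv \<alpha> t f = (THE e. \<alpha> t e = Some f)"

definition W :: "('t, 'c) monoid_scheme \<Rightarrow> 'a monoid \<Rightarrow> ('t \<Rightarrow> 'a \<Rightarrow> 'a option) \<Rightarrow> ('t \<times> 'a) restr" where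
  "W T Y \<alpha> =
     \<lparr>carrier = {(t, f). t \<in> carrier T \<and> f \<in> ran (\<alpha> t)},
      mult = (\<lambda>(t, g) (u, h). (t \<otimes>\<^bsub>T\<^esub> u, the (\<alpha> u (g \<otimes>\<^bsub>Y\<^esub> act_inv \<alpha> u h)))),
      one = (\<one>\<^bsub>T\<^esub>, \<one>\<^bsub>Y\<^esub>),
      rplus = (\<lambda>(t, g). (\<one>\<^bsub>T\<^esub>, act_inv \<alpha> t g)),
      rstar = (\<lambda>(t, g). (\<one>\<^bsub>T\<^esub>, g))\<rparr>"


section \<open>The constructions have their expected properties\<close>

lemma rterms_simps [simp]:
  "Gen x \<in> rterms X \<longleftrightarrow> x \<in> X"
  "Unit \<in> rterms X"
  "Mult s t \<in> rterms X \<longleftrightarrow> s \<in> rterms X \<and> t \<in> rterms X"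
  "Plus s \<in> rterms X \<longleftrightarrow> s \<in> rterms X"
  "Star s \<in> rterms X \<longleftrightarrow> s \<in> rterms X"
  by (auto simp: rterms_def)

lemma req_rterms: "(s, t) \<in> req X \<Longrightarrow> s \<in> rterms X \<and> t \<in> rterms X"
  by (induction rule: req.induct) auto

lemma equiv_req: "equiv (rterms X) (req X)"
proof (rule equivI)
  show "req X \<subseteq> rterms X \<times> rterms X" using req_rterms by auto
  show "refl_on (rterms X) (req X)" by (simp add: refl_on_def req.refl)
  show "sym (req X)" by (rule symI) (rule req.sym)
  show "trans (req X)" by (rule transI) (rule req.trans)
qed

lemma rclass_eq_iff:
  "s \<in> rterms X \<Longrightarrow> t \<in> rterms X \<Longrightarrow> rclass X s = rclass X t \<longleftrightarrow> (s, t) \<in> req X"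
  unfolding rclass_def by (simp add: eq_equiv_class_iff[OF equiv_req])

lemma rclass_self: "s \<in> rterms X \<Longrightarrow> s \<in> rclass X s"
  unfolding rclass_def by (simp add: req.refl)

lemma mem_rclass: "s' \<in> rclass X s \<Longrightarrow> (s, s') \<in> req X"
  unfolding rclass_def by simp

lemma rclass_eqI: "(s, t) \<in> req X \<Longrightarrow> rclass X s = rclass X t"
  using req_rterms rclass_eq_iff by metis

lemma carrier_FRM: "carrier (FRM X) = rclass X ` rterms X"
  by (auto simp: FRM_def quotient_def rclass_def)

lemma rclass_in_FRM: "s \<in> rterms X \<Longrightarrow> rclass X s \<in> carrier (FRM X)"
  by (auto simp: carrier_FRM)

lemma one_FRM: "\<one>\<^bsub>FRM X\<^esub> = rclass X Unit"
  by (simp add: FRM_def)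

lemma mult_FRM:
  assumes "s \<in> rterms X" "t \<in> rterms X"
  shows "rclass X s \<otimes>\<^bsub>FRM X\<^esub> rclass X t = rclass X (Mult s t)"
proof -
  have eq: "rclass X (Mult s' t') = rclass X (Mult s t)"
    if "s' \<in> rclass X s" "t' \<in> rclass X t" for s' t'
    by (rule rclass_eqI, rule req.sym, rule req.cong_Mult) (rule mem_rclass[OF that(1)] mem_rclass[OF that(2)])+
  have "(\<Union>s'\<in>rclass X s. \<Union>t'\<in>rclass X t. rclass X (Mult s' t')) =
      (\<Union>s'\<in>rclass X s. \<Union>t'\<in>rclass X t. rclass X (Mult s t))"
    by (intro SUP_cong[OF HOL.refl]) (rule eq; assumption)
  then show ?thesis
    using rclass_self[OF assms(1)] rclass_self[OF assms(2)] by (simp add: FRM_def) blast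
qed

lemma rplus_FRM:
  assumes "s \<in> rterms X"
  shows "rplus (FRM X) (rclass X s) = rclass X (Plus s)"
proof -
  have eq: "rclass X (Plus s') = rclass X (Plus s)" if "s' \<in> rclass X s" for s'
    by (rule rclass_eqI, rule req.sym, rule req.cong_Plus) (rule mem_rclass[OF that])
  have "(\<Union>s'\<in>rclass X s. rclass X (Plus s')) = (\<Union>s'\<in>rclass X s. rclass X (Plus s))"
    by (intro SUP_cong[OF HOL.refl]) (rule eq; assumption)
  then show ?thesis
    using rclass_self[OF assms] by (simp add: FRM_def) blast
qed

lemma rstar_FRM:
  assumes "s \<in> rterms X"
  shows "rstar (FRM X) (rclass X s) = rclass X (Star s)"
proof -
  have eq: "rclass X (Star s') = rclass X (Star s)" if "s' \<in> rclass X s" for s'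
    by (rule rclass_eqI, rule req.sym, rule req.cong_Star) (rule mem_rclass[OF that])
  have "(\<Union>s'\<in>rclass X s. rclass X (Star s')) = (\<Union>s'\<in>rclass X s. rclass X (Star s))"
    by (intro SUP_cong[OF HOL.refl]) (rule eq; assumption)
  then show ?thesis
    using rclass_self[OF assms] by (simp add: FRM_def) blast
qed

lemmas FRM_simps = one_FRM mult_FRM rplus_FRM rstar_FRM

lemma FRM_E:
  assumes "A \<in> carrier (FRM X)"
  obtains s where "s \<in> rterms X" "A = rclass X s"
  using assms by (auto simp: carrier_FRM)

lemma restriction_monoid_FRM: "restriction_monoid (FRM X)"
  by (unfold_locales; (elim FRM_E)?;
      simp add: FRM_simps rclass_in_FRM rclass_eq_iff req.assoc req.unit_left req.unit_right
        req.plus_self req.plus_plus req.plus_comm req.mult_plus req.self_star req.star_star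
        req.star_comm req.star_mult req.star_plus req.plus_star)

lemma frm_gen_closed: "x \<in> X \<Longrightarrow> frm_gen X x \<in> carrier (FRM X)"
  by (simp add: frm_gen_def rclass_in_FRM)

primrec rterm_val :: "('a, 'b) restr_scheme \<Rightarrow> ('x \<Rightarrow> 'a) \<Rightarrow> 'x rterm \<Rightarrow> 'a" where
  "rterm_val M f (Gen x) = f x"
| "rterm_val M f Unit = \<one>\<^bsub>M\<^esub>"
| "rterm_val M f (Mult s t) = rterm_val M f s \<otimes>\<^bsub>M\<^esub> rterm_val M f t"
| "rterm_val M f (Plus s) = rplus M (rterm_val M f s)"
| "rterm_val M f (Star s) = rstar M (rterm_val M f s)"

text \<open>The universal property: \<open>FRM X\<close> is free on \<open>X\<close> among restriction monoids.\<close>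

theorem FRM_universal:
  fixes M :: "('a, 'b) restr_scheme" and f :: "'x \<Rightarrow> 'a"
  assumes M: "restriction_monoid M" and f: "f \<in> X \<rightarrow> carrier M"
  shows "\<exists>!h. h \<in> restr_hom (FRM X) M \<and> h \<in> extensional (carrier (FRM X)) \<and>
              (\<forall>x\<in>X. h (frm_gen X x) = f x)"
proof -
  interpret restriction_monoid M by fact
  let ?v = "rterm_val M f"
  have cl: "?v s \<in> carrier M" if "s \<in> rterms X" for s
    using that f by (induction s) (auto simp: rplus_closed rstar_closed)
  have "?v s = ?v t" if "(s, t) \<in> req X" for s t
    using that
  proof (induction rule: req.induct)
    case (plus_comm s t) then show ?case using rplus_comm cl by simp
  next
    case (star_comm s t) then show ?case using rstar_comm cl by simp
  next
    case (mult_plus s t) then show ?case using mult_rplus cl by simp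
  next
    case (star_mult s t) then show ?case using rstar_mult cl by simp
  qed (auto simp: cl m_assoc rplus_mult_self rplus_rplus_mult mult_self_rstar rstar_mult_rstar
        rstar_rplus rplus_rstar)
  then have v: "?v (SOME u. u \<in> rclass X s) = ?v s" if "s \<in> rterms X" for s
    using mem_rclass[OF someI[of "\<lambda>u. u \<in> rclass X s", OF rclass_self[OF that]]] by simp
  define h where "h = restrict (\<lambda>A. ?v (SOME u. u \<in> A)) (carrier (FRM X))"
  have h: "h (rclass X s) = ?v s" if "s \<in> rterms X" for s
    using that by (simp add: h_def rclass_in_FRM v)
  have hh: "h \<in> restr_hom (FRM X) M"
    unfolding restr_hom_def monoid_hom_def hom_def
    by (auto simp: carrier_FRM FRM_simps h cl)
  show ?thesis
  proof (rule ex1I[of _ h])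
    show "h \<in> restr_hom (FRM X) M \<and> h \<in> extensional (carrier (FRM X)) \<and>
        (\<forall>x\<in>X. h (frm_gen X x) = f x)"
      using hh by (simp add: frm_gen_def h) (simp add: h_def)
  next
    fix k assume k: "k \<in> restr_hom (FRM X) M \<and> k \<in> extensional (carrier (FRM X)) \<and>
        (\<forall>x\<in>X. k (frm_gen X x) = f x)"
    have k1: "k \<one>\<^bsub>FRM X\<^esub> = \<one>\<^bsub>M\<^esub>"
      and km: "\<And>A B. \<lbrakk>A \<in> carrier (FRM X); B \<in> carrier (FRM X)\<rbrakk> \<Longrightarrow>
            k (A \<otimes>\<^bsub>FRM X\<^esub> B) = k A \<otimes>\<^bsub>M\<^esub> k B"
      and kp: "\<And>A. A \<in> carrier (FRM X) \<Longrightarrow> k (rplus (FRM X) A) = rplus M (k A)"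
      and ks: "\<And>A. A \<in> carrier (FRM X) \<Longrightarrow> k (rstar (FRM X) A) = rstar M (k A)"
      and kg: "\<And>x. x \<in> X \<Longrightarrow> k (frm_gen X x) = f x"
      using k by (simp_all add: restr_hom_def monoid_hom_def hom_def)
    have "k (rclass X s) = ?v s" if "s \<in> rterms X" for s
      using that
    proof (induction s)
      case (Gen x) then show ?case using kg by (simp add: frm_gen_def)
    next
      case Unit then show ?case using k1 by (simp add: one_FRM)
    next
      case (Mult s t) then show ?case
        using km[of "rclass X s" "rclass X t"] by (simp add: mult_FRM rclass_in_FRM)
    next
      case (Plus s) then show ?case
        using kp[of "rclass X s"] by (simp add: rplus_FRM rclass_in_FRM)
    next
      case (Star s) then show ?case
        using ks[of "rclass X s"] by (simp add: rstar_FRM rclass_in_FRM)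
    qed
    moreover have "h \<in> extensional (carrier (FRM X))" by (simp add: h_def)
    ultimately show "k = h"
      using k h by (intro extensionalityI[of k "carrier (FRM X)"]) (auto simp: carrier_FRM)
  qed
qed

lemma word_ext_hom:
  fixes M :: "('a, 'b) monoid_scheme"
  assumes "monoid M" "g \<in> X \<rightarrow> carrier M"
  shows "word_ext M g \<in> monoid_hom (free_monoid X) M"
    and "x \<in> X \<Longrightarrow> word_ext M g [x] = g x"
proof -
  interpret monoid M by fact
  have cl: "word_ext M g w \<in> carrier M" if "w \<in> lists X" for w
    using that assms(2) by (induction w) (auto simp: word_ext_def)
  have "word_ext M g (w @ w') = word_ext M g w \<otimes>\<^bsub>M\<^esub> word_ext M g w'"
    if "w \<in> lists X" "w' \<in> lists X" for w w'
    using that(1)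
  proof (induction w)
    case Nil show ?case using cl[OF that(2)] by (simp add: word_ext_def)
  next
    case (Cons x w)
    then have "g x \<in> carrier M" using assms(2) by auto
    then show ?case using Cons cl[of w] cl[OF that(2)] by (simp add: word_ext_def m_assoc)
  qed
  with cl show "word_ext M g \<in> monoid_hom (free_monoid X) M"
    unfolding monoid_hom_def hom_def by (auto simp: free_monoid_def) (simp add: word_ext_def)
  show "x \<in> X \<Longrightarrow> word_ext M g [x] = g x"
    using assms(2) by (auto simp: word_ext_def Pi_iff)
qed

lemma act_inv_eq:
  assumes "\<alpha> t \<in> carrier (munn_semigroup Y)" "\<alpha> t e = Some f"
  shows "act_inv \<alpha> t f = e"
proof -
  obtain a where a: "dom (\<alpha> t) = principal_ideal Y a"
      "inj_on (\<lambda>e. the (\<alpha> t e)) (principal_ideal Y a)"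
    using assms(1) by (auto simp: munn_semigroup_def iso_def bij_betw_def)
  have "e' = e" if "\<alpha> t e' = Some f" for e'
    using inj_onD[OF a(2), of e' e] a(1) assms(2) that by (auto simp: dom_def)
  then show ?thesis unfolding act_inv_def using assms(2) by (rule the_equality[rotated])
qed

text \<open>The operations of \<open>W(T, Y)\<close> on elements written as \<open>(t, e\<^sup>t)\<close>.\<close>

lemma W_ops:
  assumes "\<alpha> \<in> monoid_hom T (munn_semigroup Y)" "t \<in> carrier T" "u \<in> carrier T"
    and "e \<in> dom (\<alpha> t)" "f \<in> dom (\<alpha> u)"
  shows "(t, the (\<alpha> t e)) \<otimes>\<^bsub>W T Y \<alpha>\<^esub> (u, the (\<alpha> u f)) =
           (t \<otimes>\<^bsub>T\<^esub> u, the (\<alpha> u (the (\<alpha> t e) \<otimes>\<^bsub>Y\<^esub> f)))"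
    and "rplus (W T Y \<alpha>) (t, the (\<alpha> t e)) = (\<one>\<^bsub>T\<^esub>, e)"
    and "rstar (W T Y \<alpha>) (t, the (\<alpha> t e)) = (\<one>\<^bsub>T\<^esub>, the (\<alpha> t e))"
proof -
  have "\<alpha> t \<in> carrier (munn_semigroup Y)" "\<alpha> u \<in> carrier (munn_semigroup Y)"
    using assms(1-3) by (auto simp: monoid_hom_def hom_def)
  then have "act_inv \<alpha> t (the (\<alpha> t e)) = e" "act_inv \<alpha> u (the (\<alpha> u f)) = f"
    using assms(4,5) by (auto intro!: act_inv_eq)
  then show "(t, the (\<alpha> t e)) \<otimes>\<^bsub>W T Y \<alpha>\<^esub> (u, the (\<alpha> u f)) =
           (t \<otimes>\<^bsub>T\<^esub> u, the (\<alpha> u (the (\<alpha> t e) \<otimes>\<^bsub>Y\<^esub> f)))"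
    "rplus (W T Y \<alpha>) (t, the (\<alpha> t e)) = (\<one>\<^bsub>T\<^esub>, e)"
    "rstar (W T Y \<alpha>) (t, the (\<alpha> t e)) = (\<one>\<^bsub>T\<^esub>, the (\<alpha> t e))"
    by (simp_all add: W_def)
qed

end

(* Freeness gives a map sigma from FRM X onto the free monoid, viewed as a restriction monoid in
   which every projection is the identity; sigma is left inverse to frm_word X. Elements of the
   form projection times word contain the generators and are closed under the operations, so
   every a equals rplus a times the image of the word sigma a. Hence a is determined by the pair
   of sigma a and rstar a, and sending a to this pair is the isomorphism. *)

theory Submission
  imports Defs
begin

section \<open>Projections\<close>

context restriction_monoid
begin

abbreviation P :: "'a set" where
  "P \<equiv> carrier (projections S)"

lemma mult_projections [simp]: "x \<otimes>\<^bsub>projections S\<^esub> y = x \<otimes> y"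
  and one_projections [simp]: "\<one>\<^bsub>projections S\<^esub> = \<one>"
  by (simp_all add: projections_def)

lemma rplus_in_P [simp]: "x \<in> carrier S \<Longrightarrow> rplus S x \<in> P"
  by (simp add: projections_def)

lemma P_cases:
  assumes "e \<in> P"
  obtains x where "x \<in> carrier S" "e = rplus S x"
  using assms by (auto simp: projections_def)

lemma rstar_in_P [simp]: "x \<in> carrier S \<Longrightarrow> rstar S x \<in> P"
  by (metis rplus_in_P rplus_rstar rstar_closed)

lemma P_closed [simp]: "e \<in> P \<Longrightarrow> e \<in> carrier S"
  by (auto elim: P_cases simp: rplus_closed)

lemma P_rstar: "e \<in> P \<Longrightarrow> rstar S e = e"
  by (auto elim: P_cases simp: rstar_rplus)

lemma P_rplus: "e \<in> P \<Longrightarrow> rplus S e = e"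
  by (metis P_closed P_rstar rplus_rstar)

lemma P_comm: "e \<in> P \<Longrightarrow> f \<in> P \<Longrightarrow> e \<otimes> f = f \<otimes> e"
  by (auto elim!: P_cases simp: rplus_comm)

lemma P_idem: "e \<in> P \<Longrightarrow> e \<otimes> e = e"
  by (metis P_closed P_rplus rplus_mult_self)

lemma rplus_P_mult: "e \<in> P \<Longrightarrow> x \<in> carrier S \<Longrightarrow> rplus S (e \<otimes> x) = e \<otimes> rplus S x"
  by (auto elim!: P_cases simp: rplus_rplus_mult)

lemma rstar_mult_P: "e \<in> P \<Longrightarrow> x \<in> carrier S \<Longrightarrow> rstar S (x \<otimes> e) = rstar S x \<otimes> e"
  by (metis P_closed P_rstar rstar_mult_rstar)

text \<open>With its mirror image \<open>P_mult\<close>, this carries a projection across an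
  element. The axioms speak of values of \<open>rplus\<close> and \<open>rstar\<close> only, but
  each projection is its own \<open>rplus\<close> and its own \<open>rstar\<close>.\<close>

lemma mult_P: "e \<in> P \<Longrightarrow> x \<in> carrier S \<Longrightarrow> x \<otimes> e = rplus S (x \<otimes> e) \<otimes> x"
  by (metis P_closed P_rplus mult_rplus)

lemma P_mult: "e \<in> P \<Longrightarrow> x \<in> carrier S \<Longrightarrow> e \<otimes> x = x \<otimes> rstar S (e \<otimes> x)"
  by (metis P_closed P_rstar rstar_mult)

lemma P_mult_closed [simp]: "e \<in> P \<Longrightarrow> f \<in> P \<Longrightarrow> e \<otimes> f \<in> P"
  by (metis P_closed P_rplus m_closed rplus_P_mult rplus_in_P)

lemma rplus_one: "rplus S \<one> = \<one>"
  by (metis one_closed r_one rplus_closed rplus_mult_self)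

lemma rstar_one: "rstar S \<one> = \<one>"
  by (metis one_closed rplus_one rstar_rplus)

lemma one_in_P [simp]: "\<one> \<in> P"
  by (metis one_closed rplus_in_P rplus_one)

lemma semilattice_monoid_projections: "semilattice_monoid (projections S)"
  by unfold_locales (simp_all add: P_idem m_assoc, simp add: P_comm)

text \<open>By \<open>rstar_mult\<close>, the element \<open>rstar S x\<close> crosses
  \<open>y\<close> and becomes \<open>rstar S (x \<otimes> y)\<close>; the leftover factor
  \<open>rstar S y\<close> is absorbed because \<open>y = y \<otimes> rstar S y\<close>. This makes
  the values of the Munn maps compose correctly.\<close>

lemma rstar_mult_left:
  assumes "x \<in> carrier S" "y \<in> carrier S"
  shows "rstar S (rstar S x \<otimes> y) = rstar S (x \<otimes> y)"
proof -
  have "rstar S (rstar S x \<otimes> y) = rstar S (y \<otimes> rstar S (x \<otimes> y))"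
    using assms rstar_mult by simp
  also have "\<dots> = rstar S (x \<otimes> y) \<otimes> rstar S y"
    using assms by (simp add: rstar_mult_rstar P_comm)
  also have "\<dots> = rstar S (x \<otimes> y)"
    using assms by (metis m_assoc m_closed mult_self_rstar rstar_closed rstar_mult_rstar)
  finally show ?thesis .
qed

lemma rplus_mult_right:
  assumes "x \<in> carrier S" "y \<in> carrier S"
  shows "rplus S (x \<otimes> rplus S y) = rplus S (x \<otimes> y)"
proof -
  have "rplus S (x \<otimes> rplus S y) = rplus S (rplus S (x \<otimes> y) \<otimes> x)"
    using assms mult_rplus by simp
  also have "\<dots> = rplus S x \<otimes> rplus S (x \<otimes> y)"
    using assms by (simp add: rplus_rplus_mult P_comm)
  also have "\<dots> = rplus S (x \<otimes> y)"
    using assms by (metis m_assoc m_closed rplus_mult_self rplus_closed rplus_rplus_mult)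
  finally show ?thesis .
qed

text \<open>An inequality in the order of the projections. It results from taking
  \<open>rplus\<close> of both sides of \<open>mult_rplus\<close>.\<close>

lemma rplus_mult_le:
  assumes "x \<in> carrier S" "y \<in> carrier S"
  shows "rplus S (x \<otimes> y) \<otimes> rplus S x = rplus S (x \<otimes> y)"
  using assms by (metis m_closed mult_rplus rplus_mult_right rplus_rplus_mult)

lemma rstar_mult_le:
  assumes "x \<in> carrier S" "y \<in> carrier S"
  shows "rstar S (x \<otimes> y) \<otimes> rstar S y = rstar S (x \<otimes> y)"
  using assms by (simp add: m_assoc mult_self_rstar rstar_closed flip: rstar_mult_rstar)


section \<open>The Munn representation\<close>

abbreviation \<theta> :: "'a \<Rightarrow> 'a \<Rightarrow> 'a option" where
  "\<theta> \<equiv> munn_rep S"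

lemma mem_principal_ideal:
  "e \<in> principal_ideal (projections S) a \<longleftrightarrow> e \<in> P \<and> e \<otimes> a = e"
  by (auto simp: principal_ideal_def sl_le_def)

lemma munn_rep_eq_Some:
  "\<theta> a e = Some f \<longleftrightarrow> e \<in> P \<and> e \<otimes> rplus S a = e \<and> f = rstar S (e \<otimes> a)"
  by (auto simp: munn_rep_def mem_principal_ideal)

text \<open>The map \<open>f \<mapsto> rplus S (a \<otimes> f)\<close> inverts the Munn map of
  \<open>a\<close>. In this round trip \<open>P_mult\<close> turns the argument of
  \<open>rplus\<close> back into \<open>e \<otimes> a\<close>; \<open>rstar_rplus_mult_mult\<close>
  is the other one, through \<open>mult_P\<close>.\<close>

lemma rplus_mult_rstar_mult:
  assumes "a \<in> carrier S" "e \<in> P" "e \<otimes> rplus S a = e"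
  shows "rplus S (a \<otimes> rstar S (e \<otimes> a)) = e"
  using assms P_mult[of e a] rplus_P_mult[of e a] by simp

lemma rstar_rplus_mult_mult:
  assumes "a \<in> carrier S" "f \<in> P" "f \<otimes> rstar S a = f"
  shows "rstar S (rplus S (a \<otimes> f) \<otimes> a) = f"
  using assms mult_P[of f a] rstar_mult_P[of f a] P_comm[of f "rstar S a"] by simp

lemma munn_rep_closed:
  assumes a: "a \<in> carrier S"
  shows "\<theta> a \<in> carrier (munn_semigroup (projections S))"
proof -
  let ?I = "principal_ideal (projections S) (rplus S a)"
  let ?J = "principal_ideal (projections S) (rstar S a)"
  let ?g = "\<lambda>e. the (\<theta> a e)"
  have dom: "dom (\<theta> a) = ?I"
    by (auto simp: munn_rep_def split: if_splits)
  have g: "?g e = rstar S (e \<otimes> a)" if "e \<in> ?I" for e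
    using that by (simp add: munn_rep_def)
  have gJ: "?g e \<in> ?J" if "e \<in> ?I" for e
    using that a g[OF that] by (simp add: mem_principal_ideal rstar_mult_le)
  have mult: "?g (e \<otimes> f) = ?g e \<otimes> ?g f" if "e \<in> ?I" "f \<in> ?I" for e f
  proof -
    have e: "e \<in> P" and f: "f \<in> P" using that by (auto simp: mem_principal_ideal)
    have "e \<otimes> f \<in> ?I" using that a by (simp add: mem_principal_ideal m_assoc)
    then have "?g (e \<otimes> f) = rstar S (e \<otimes> (f \<otimes> a))"
      using a e f by (simp add: g m_assoc)
    \<comment> \<open>Once \<open>f\<close> has crossed \<open>a\<close>, it stands on the right as
      a projection, which \<open>rstar_mult_P\<close> can split off.\<close>
    also have "f \<otimes> a = a \<otimes> rstar S (f \<otimes> a)"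
      using a f by (rule P_mult[rotated])
    also have "rstar S (e \<otimes> (a \<otimes> rstar S (f \<otimes> a))) = rstar S (e \<otimes> a \<otimes> rstar S (f \<otimes> a))"
      using a e f by (simp add: m_assoc rstar_closed)
    also have "\<dots> = rstar S (e \<otimes> a) \<otimes> rstar S (f \<otimes> a)"
      using a e f by (simp add: rstar_mult_P)
    finally show ?thesis using that by (simp add: g)
  qed
  have gI: "rplus S (a \<otimes> f) \<in> ?I" if "f \<in> ?J" for f
    using that a by (simp add: mem_principal_ideal rplus_mult_le)
  have "bij_betw ?g ?I ?J"
  proof (rule bij_betw_byWitness[where f' = "\<lambda>f. rplus S (a \<otimes> f)"])
    show "\<forall>e\<in>?I. rplus S (a \<otimes> ?g e) = e"
      using a by (simp add: g) (simp add: mem_principal_ideal rplus_mult_rstar_mult)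
    show "\<forall>f\<in>?J. ?g (rplus S (a \<otimes> f)) = f"
      using a gI by (simp add: g) (simp add: mem_principal_ideal rstar_rplus_mult_mult)
  qed (use gJ gI in blast)+
  then have "?g \<in> iso (projections S\<lparr>carrier := ?I\<rparr>) (projections S\<lparr>carrier := ?J\<rparr>)"
    using gJ mult by (simp add: iso_def hom_def)
  then show ?thesis
    unfolding munn_semigroup_def using dom rplus_in_P[OF a] rstar_in_P[OF a] by auto
qed

lemma munn_rep_mult:
  assumes a: "a \<in> carrier S" and b: "b \<in> carrier S"
  shows "\<theta> (a \<otimes> b) = \<theta> b \<circ>\<^sub>m \<theta> a"
proof
  fix e
  \<comment> \<open>Equality of the domains. The bridge is the equation
    \<open>e \<otimes> a \<otimes> rplus S b = e \<otimes> a\<close>, which each side implies: its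
    \<open>rplus\<close> yields the condition on the left, its \<open>rstar\<close> the second
    condition on the right.\<close>
  have le: "e \<otimes> rplus S (a \<otimes> b) = e \<longleftrightarrow>
      e \<otimes> rplus S a = e \<and> rstar S (e \<otimes> a) \<otimes> rplus S b = rstar S (e \<otimes> a)" if e: "e \<in> P"
  proof -
    have "rplus S (e \<otimes> a \<otimes> rplus S b) = e \<otimes> rplus S (a \<otimes> b)"
      using a b e by (simp add: m_assoc rplus_mult_right rplus_P_mult rplus_closed)
    moreover have "rstar S (e \<otimes> a \<otimes> rplus S b) = rstar S (e \<otimes> a) \<otimes> rplus S b"
      using a b e by (simp add: rstar_mult_P)
    moreover have "rplus S (e \<otimes> a) = e \<otimes> rplus S a"
      using a e by (simp add: rplus_P_mult)
    moreover have "rplus S (a \<otimes> b) \<otimes> rplus S a = rplus S (a \<otimes> b)"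
      using a b by (rule rplus_mult_le)
    moreover have "e \<otimes> a \<otimes> rplus S b = e \<otimes> a"
      if "e \<otimes> rplus S (a \<otimes> b) = e"
    proof -
      have "e \<otimes> a \<otimes> rplus S b = e \<otimes> rplus S (a \<otimes> b) \<otimes> a"
        using a b e by (simp add: m_assoc mult_rplus rplus_closed)
      with that show ?thesis by simp
    qed
    \<comment> \<open>Here \<open>e \<otimes> a\<close> is expanded by its own \<open>rstar\<close>,
      which absorbs \<open>rplus S b\<close>.\<close>
    moreover have "e \<otimes> a \<otimes> rplus S b = e \<otimes> a"
      if "rstar S (e \<otimes> a) \<otimes> rplus S b = rstar S (e \<otimes> a)"
      using that a b e by (metis P_closed m_assoc m_closed mult_self_rstar rplus_closed rstar_closed)
    ultimately show ?thesis
      using a b e by (metis P_closed m_assoc m_closed rplus_closed)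
  qed
  have "rstar S (rstar S (e \<otimes> a) \<otimes> b) = rstar S (e \<otimes> (a \<otimes> b))" if "e \<in> P"
    using a b that by (simp add: rstar_mult_left m_assoc)
  then show "\<theta> (a \<otimes> b) e = (\<theta> b \<circ>\<^sub>m \<theta> a) e"
    using a b le by (auto simp: map_comp_def munn_rep_def mem_principal_ideal)
qed

lemma munn_rep_one: "\<theta> \<one> = Some |` P"
  by (auto simp: fun_eq_iff restrict_map_def munn_rep_def mem_principal_ideal rplus_one P_rstar)

lemma munn_rep_hom:
  assumes "\<nu> \<in> monoid_hom T S"
  shows "(\<lambda>t. \<theta> (\<nu> t)) \<in> monoid_hom T (munn_semigroup (projections S))"
proof -
  have closed: "\<nu> t \<in> carrier S" if "t \<in> carrier T" for t
    using assms that by (auto simp: monoid_hom_def hom_def)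
  have "\<theta> (\<nu> (s \<otimes>\<^bsub>T\<^esub> t)) = \<theta> (\<nu> t) \<circ>\<^sub>m \<theta> (\<nu> s)" if "s \<in> carrier T" "t \<in> carrier T" for s t
    using assms that by (simp add: monoid_hom_def hom_def munn_rep_mult closed)
  moreover have "\<theta> (\<nu> \<one>\<^bsub>T\<^esub>) = Some |` P"
    using assms by (simp add: monoid_hom_def munn_rep_one)
  moreover have "\<theta> (\<nu> t) \<in> carrier (munn_semigroup (projections S))" if "t \<in> carrier T" for t
    using that by (simp add: closed munn_rep_closed)
  ultimately show ?thesis
    by (simp add: monoid_hom_def hom_def) (simp add: munn_semigroup_def)
qed


section \<open>Splittings of the projections\<close>

text \<open>Collects what freeness has to supply. By \<open>split\<close>, the action of
  \<open>\<sigma> a\<close> carries \<open>rplus S a\<close> to \<open>rstar S a\<close>. The pair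
  of \<open>\<sigma> a\<close> and \<open>rstar S a\<close> therefore determines
  \<open>rplus S a\<close>, and \<open>split\<close> then restores \<open>a\<close>.\<close>

lemma restr_isomorphic_W:
  fixes T :: "('t, 'c) monoid_scheme"
  assumes \<nu>: "\<nu> \<in> monoid_hom T S" and \<sigma>: "\<sigma> \<in> monoid_hom S T"
    and \<sigma>P: "\<And>e. e \<in> P \<Longrightarrow> \<sigma> e = \<one>\<^bsub>T\<^esub>"
    and \<sigma>\<nu>: "\<And>t. t \<in> carrier T \<Longrightarrow> \<sigma> (\<nu> t) = t"
    and split: "\<And>a. a \<in> carrier S \<Longrightarrow> rplus S a \<otimes> \<nu> (\<sigma> a) = a"
    and T: "monoid T"
  shows "restr_isomorphic S (W T (projections S) (\<lambda>t. \<theta> (\<nu> t)))"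
proof -
  interpret T: monoid T by fact
  let ?\<alpha> = "\<lambda>t. \<theta> (\<nu> t)"
  let ?W = "W T (projections S) ?\<alpha>"
  let ?h = "\<lambda>a. (\<sigma> a, rstar S a)"
  have \<nu>c [simp]: "\<nu> t \<in> carrier S" if "t \<in> carrier T" for t
    using \<nu> that by (auto simp: monoid_hom_def hom_def)
  have \<sigma>c [simp]: "\<sigma> a \<in> carrier T" if "a \<in> carrier S" for a
    using \<sigma> that by (auto simp: monoid_hom_def hom_def)
  have \<sigma>m: "\<sigma> (a \<otimes> b) = \<sigma> a \<otimes>\<^bsub>T\<^esub> \<sigma> b" if "a \<in> carrier S" "b \<in> carrier S" for a b
    using \<sigma> that by (auto simp: monoid_hom_def hom_def)
  have \<sigma>1: "\<sigma> \<one> = \<one>\<^bsub>T\<^esub>"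
    using \<sigma> by (auto simp: monoid_hom_def)
  \<comment> \<open>Taking \<open>rplus\<close> in \<open>split\<close> places
    \<open>rplus S a\<close> in the domain of the action of \<open>\<sigma> a\<close>.\<close>
  have le: "rplus S a \<otimes> rplus S (\<nu> (\<sigma> a)) = rplus S a" if "a \<in> carrier S" for a
    using that split[OF that] by (metis \<nu>c \<sigma>c rplus_rplus_mult)
  \<comment> \<open>Thus \<open>?h a\<close> is the pair \<open>(t, e\<^sup>t)\<close> with
    \<open>t = \<sigma> a\<close> and \<open>e = rplus S a\<close>.\<close>
  have val: "?\<alpha> (\<sigma> a) (rplus S a) = Some (rstar S a)" if "a \<in> carrier S" for a
    using that by (simp add: munn_rep_eq_Some le split)
  have inv: "act_inv ?\<alpha> (\<sigma> a) (rstar S a) = rplus S a" if "a \<in> carrier S" for a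
    by (rule act_inv_eq[where Y = "projections S"]) (use that in \<open>simp_all add: val munn_rep_closed\<close>)
  have mult: "?h (a \<otimes> b) = ?h a \<otimes>\<^bsub>?W\<^esub> ?h b" if a: "a \<in> carrier S" and b: "b \<in> carrier S" for a b
  proof -
    \<comment> \<open>By \<open>inv\<close>, the left side computes the second component of the
      product in \<open>?W\<close>. On the right, \<open>split\<close> reassembles
      \<open>b\<close>.\<close>
    have "?\<alpha> (\<sigma> b) (rstar S a \<otimes> rplus S b) =
        Some (rstar S (rstar S a \<otimes> (rplus S b \<otimes> \<nu> (\<sigma> b))))"
      using a b by (simp add: munn_rep_eq_Some m_assoc le rstar_closed rplus_closed)
    also have "\<dots> = Some (rstar S (a \<otimes> b))"
      using a b by (simp add: split rstar_mult_left)
    finally show ?thesis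
      using a b by (simp add: W_def inv \<sigma>m)
  qed
  have closed: "?h a \<in> carrier ?W" if "a \<in> carrier S" for a
    using that val[OF that] by (auto simp: W_def ran_def)
  have one: "?h \<one> = \<one>\<^bsub>?W\<^esub>"
    by (simp add: W_def \<sigma>1 rstar_one)
  have rplus: "?h (rplus S a) = rplus ?W (?h a)" if "a \<in> carrier S" for a
    using that by (simp add: W_def inv \<sigma>P P_rstar)
  have rstar: "?h (rstar S a) = rstar ?W (?h a)" if "a \<in> carrier S" for a
    using that by (simp add: W_def \<sigma>P P_rstar)
  have "?h \<in> restr_hom S ?W"
    using closed one mult rplus rstar by (simp add: restr_hom_def monoid_hom_def hom_def)
  moreover have "bij_betw ?h (carrier S) (carrier ?W)"
  proof (rule bij_betwI')
    fix a b assume a: "a \<in> carrier S" and b: "b \<in> carrier S"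
    show "?h a = ?h b \<longleftrightarrow> a = b"
    proof
      assume "?h a = ?h b"
      then show "a = b" using inv[OF a] inv[OF b] split[OF a] split[OF b] by simp
    qed simp
  next
    fix a assume "a \<in> carrier S"
    then show "?h a \<in> carrier ?W" by (rule closed)
  next
    fix y assume "y \<in> carrier ?W"
    then obtain t f e where y: "y = (t, f)" and t: "t \<in> carrier T"
        and e: "e \<in> P" "f = rstar S (e \<otimes> \<nu> t)"
      by (auto simp: W_def ran_def munn_rep_eq_Some)
    \<comment> \<open>The preimage of \<open>(t, e\<^sup>t)\<close> is
      \<open>e \<otimes> \<nu> t\<close>: \<open>\<sigma>\<close> erases \<open>e\<close> and sends
      \<open>\<nu> t\<close> back to \<open>t\<close>.\<close>
    have "y = ?h (e \<otimes> \<nu> t)"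
      using y t e by (simp add: \<sigma>m \<sigma>P \<sigma>\<nu>)
    then show "\<exists>a\<in>carrier S. y = ?h a" by (rule bexI) (simp add: t e)
  qed
  ultimately show ?thesis unfolding restr_isomorphic_def by blast
qed

text \<open>Whatever projection \<open>e\<close> occurs in a factorisation of \<open>a\<close>, it
  may be replaced by \<open>rplus S a\<close>. Indeed
  \<open>rplus S a = e \<otimes> rplus S b\<close>, and the second factor fixes
  \<open>b\<close>.\<close>

lemma rplus_mult_split:
  assumes "e \<in> P" "b \<in> carrier S" "a = e \<otimes> b"
  shows "rplus S a \<otimes> b = a"
  using assms by (simp add: rplus_P_mult m_assoc rplus_mult_self rplus_closed)

end


section \<open>The free restriction monoid\<close>

text \<open>Known as a reduced restriction monoid. It makes the free monoid an admissible target for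
  \<open>FRM_universal\<close>.\<close>

definition reduced_restr :: "'a monoid \<Rightarrow> 'a restr" where
  "reduced_restr M =
     \<lparr>carrier = carrier M, mult = mult M, one = one M, rplus = (\<lambda>_. one M), rstar = (\<lambda>_. one M)\<rparr>"

lemma restriction_monoid_reduced_restr:
  assumes "monoid M"
  shows "restriction_monoid (reduced_restr M)"
proof -
  interpret monoid M by fact
  show ?thesis by unfold_locales (auto simp: reduced_restr_def m_assoc)
qed

lemma monoid_free_monoid: "monoid (free_monoid X)"
  by unfold_locales (auto simp: free_monoid_def)

lemma frm_gen_Pi: "frm_gen X \<in> X \<rightarrow> carrier (FRM X)"
  by (simp add: frm_gen_closed)

lemma frm_word_hom: "frm_word X \<in> monoid_hom (free_monoid X) (FRM X)"
  unfolding frm_word_def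
  by (intro word_ext_hom frm_gen_Pi restriction_monoid.axioms(1)[OF restriction_monoid_FRM])

lemma frm_word_Cons: "frm_word X (x # w) = frm_gen X x \<otimes>\<^bsub>FRM X\<^esub> frm_word X w"
  by (simp add: frm_word_def word_ext_def)

theorem corollary7p2:
  fixes X :: "'x set"
  shows "semilattice_monoid (projections (FRM X)) \<and>
         (\<lambda>w. munn_rep (FRM X) (frm_word X w))
           \<in> monoid_hom (free_monoid X) (munn_semigroup (projections (FRM X))) \<and>
         restr_isomorphic (FRM X)
           (W (free_monoid X) (projections (FRM X)) (\<lambda>w. munn_rep (FRM X) (frm_word X w)))"
proof -
  interpret F: restriction_monoid "FRM X" by (rule restriction_monoid_FRM)
  let ?M = "reduced_restr (free_monoid X)"
  let ?w = "frm_word X"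
  have wc [simp]: "?w w \<in> carrier (FRM X)" if "w \<in> lists X" for w
    using frm_word_hom[of X] that by (auto simp: monoid_hom_def hom_def free_monoid_def)
  have wm: "?w (u @ v) = ?w u \<otimes>\<^bsub>FRM X\<^esub> ?w v" if "u \<in> lists X" "v \<in> lists X" for u v
    using frm_word_hom[of X] that by (auto simp: monoid_hom_def hom_def free_monoid_def)
  have w1: "?w [] = \<one>\<^bsub>FRM X\<^esub>"
    by (simp add: frm_word_def word_ext_def)
  have "(\<lambda>x. [x]) \<in> X \<rightarrow> carrier ?M"
    by (auto simp: reduced_restr_def free_monoid_def)
  from FRM_universal[OF restriction_monoid_reduced_restr[OF monoid_free_monoid] this]
  obtain \<sigma> where \<sigma>: "\<sigma> \<in> restr_hom (FRM X) ?M" and \<sigma>g: "\<And>x. x \<in> X \<Longrightarrow> \<sigma> (frm_gen X x) = [x]"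
    by auto
  have \<sigma>hom: "\<sigma> \<in> monoid_hom (FRM X) (free_monoid X)"
    using \<sigma> by (auto simp: restr_hom_def monoid_hom_def hom_def reduced_restr_def)
  have \<sigma>c [simp]: "\<sigma> a \<in> lists X" if "a \<in> carrier (FRM X)" for a
    using \<sigma>hom that by (auto simp: monoid_hom_def hom_def free_monoid_def)
  have \<sigma>m: "\<sigma> (a \<otimes>\<^bsub>FRM X\<^esub> b) = \<sigma> a @ \<sigma> b"
    if "a \<in> carrier (FRM X)" "b \<in> carrier (FRM X)" for a b
    using \<sigma>hom that by (auto simp: monoid_hom_def hom_def free_monoid_def)
  have \<sigma>1: "\<sigma> \<one>\<^bsub>FRM X\<^esub> = []"
    using \<sigma>hom by (auto simp: monoid_hom_def free_monoid_def)
  have \<sigma>P: "\<sigma> e = []" if "e \<in> F.P" for e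
    using \<sigma> that
    by (auto simp: restr_hom_def reduced_restr_def projections_def free_monoid_def)
  have \<sigma>w: "\<sigma> (?w w) = w" if "w \<in> lists X" for w
    using that by (induction w) (auto simp: w1 \<sigma>1 frm_word_Cons \<sigma>m \<sigma>g frm_gen_closed)
  \<comment> \<open>The word of a projection is empty. This settles the cases \<open>Unit\<close>,
    \<open>Plus\<close> and \<open>Star\<close> of the induction below.\<close>
  have P_split: "rplus (FRM X) e \<otimes>\<^bsub>FRM X\<^esub> ?w (\<sigma> e) = e" if "e \<in> F.P" for e
    using that by (simp add: \<sigma>P w1 F.P_rplus)
  \<comment> \<open>Every element is the class of a term, so induction on terms checks the
    generators and closure under the operations.\<close>
  have split: "rplus (FRM X) (rclass X s) \<otimes>\<^bsub>FRM X\<^esub> ?w (\<sigma> (rclass X s)) = rclass X s"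
    if "s \<in> rterms X" for s
    using that
  proof (induction s)
    case (Gen x)
    then have "?w (\<sigma> (rclass X (Gen x))) = rclass X (Gen x)"
      using \<sigma>g[of x] by (simp add: frm_gen_def frm_word_Cons w1 rclass_in_FRM)
    with Gen show ?case by (simp add: F.rplus_mult_self rclass_in_FRM)
  next
    case Unit
    show ?case by (metis F.one_in_P P_split one_FRM)
  next
    case (Mult s t)
    define a b where "a = rclass X s" and "b = rclass X t"
    have ab: "a \<in> carrier (FRM X)" "b \<in> carrier (FRM X)"
      using Mult.prems by (simp_all add: a_def b_def rclass_in_FRM)
    have ia: "rplus (FRM X) a \<otimes>\<^bsub>FRM X\<^esub> ?w (\<sigma> a) = a"
      and ib: "rplus (FRM X) b \<otimes>\<^bsub>FRM X\<^esub> ?w (\<sigma> b) = b"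
      using Mult by (simp_all add: a_def b_def)
    \<comment> \<open>In \<open>b\<close>, written as projection times word,
      \<open>mult_rplus\<close> pulls the projection leftwards across \<open>a\<close>, where it
      becomes the \<open>rplus\<close> of the product.\<close>
    have "a \<otimes>\<^bsub>FRM X\<^esub> b = rplus (FRM X) (a \<otimes>\<^bsub>FRM X\<^esub> b) \<otimes>\<^bsub>FRM X\<^esub> (a \<otimes>\<^bsub>FRM X\<^esub> ?w (\<sigma> b))"
    proof -
      have "a \<otimes>\<^bsub>FRM X\<^esub> b = a \<otimes>\<^bsub>FRM X\<^esub> rplus (FRM X) b \<otimes>\<^bsub>FRM X\<^esub> ?w (\<sigma> b)"
        using ab ib by (simp add: F.m_assoc F.rplus_closed)
      then show ?thesis
        using ab F.mult_rplus[OF ab] by (simp add: F.m_assoc F.rplus_closed)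
    qed
    also have "a \<otimes>\<^bsub>FRM X\<^esub> ?w (\<sigma> b) = rplus (FRM X) a \<otimes>\<^bsub>FRM X\<^esub> ?w (\<sigma> (a \<otimes>\<^bsub>FRM X\<^esub> b))"
      using ab ia by (metis F.m_assoc F.rplus_closed \<sigma>c \<sigma>m wc wm)
    finally have "a \<otimes>\<^bsub>FRM X\<^esub> b = rplus (FRM X) (a \<otimes>\<^bsub>FRM X\<^esub> b) \<otimes>\<^bsub>FRM X\<^esub> rplus (FRM X) a
        \<otimes>\<^bsub>FRM X\<^esub> ?w (\<sigma> (a \<otimes>\<^bsub>FRM X\<^esub> b))"
      using ab by (simp add: F.m_assoc F.rplus_closed)
    \<comment> \<open>All projections now stand in front of a single word;
      \<open>rplus_mult_split\<close> replaces their product by the required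
      \<open>rplus\<close>.\<close>
    then have "rplus (FRM X) (a \<otimes>\<^bsub>FRM X\<^esub> b) \<otimes>\<^bsub>FRM X\<^esub> ?w (\<sigma> (a \<otimes>\<^bsub>FRM X\<^esub> b)) = a \<otimes>\<^bsub>FRM X\<^esub> b"
      using ab by (intro F.rplus_mult_split) simp_all
    then show ?case using Mult.prems by (simp add: a_def b_def mult_FRM)
  next
    case (Plus s)
    then show ?case
      using P_split[of "rplus (FRM X) (rclass X s)"] by (simp add: rclass_in_FRM) (simp add: rplus_FRM)
  next
    case (Star s)
    then show ?case
      using P_split[of "rstar (FRM X) (rclass X s)"] by (simp add: rclass_in_FRM) (simp add: rstar_FRM)
  qed
  have "restr_isomorphic (FRM X)
      (W (free_monoid X) (projections (FRM X)) (\<lambda>w. munn_rep (FRM X) (?w w)))"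
    by (rule F.restr_isomorphic_W[OF frm_word_hom \<sigma>hom])
      (auto simp: \<sigma>P \<sigma>w free_monoid_def split monoid_free_monoid[unfolded free_monoid_def]
        elim: FRM_E)
  then show ?thesis
    using F.semilattice_monoid_projections F.munn_rep_hom[OF frm_word_hom] by blast
qed

end
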